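(* Let $\rho\in\mathcal{P}(\Omega)$ and consider the decomposition $$\rho=\rho_c+\sum_{i=1}^\infty m_i\delta_{x_i},\qquad x_i\in\Omega\text{ pairwise distinct},\ m_i\ge0\text{ for all }i\ge1,$$ with $\rho_c\in\mathcal{M}_+(\Omega)$ atomless. Then $\nu=\sum_{i=1}^\infty m_i^2\,\delta_{x_i}$ is the unique minimizer of $$\inf\Big\{\int_\Omega\mathrm{Hell}^2(\delta_x,\nu)\,d\rho(x)\;\Big|\;\nu\in\mathcal{M}_+(\Omega)\Big\}.$$
   Context: $\Omega \subset \mathbb{R}^d$ is a compact convex set with non-empty interior. $\mathcal{M}_+(\Omega)$ and $\mathcal{P}(\Omega)$ denote the non-negative Radon measures and probability measures on $\Omega$. For $\mu,\nu\in\mathcal{M}_+(\Omega)$ the Hellinger distance is $\mathrm{Hell}^2(\mu,\nu):=\int_\Omega\big(\sqrt{d\mu/d\tau}-\sqrt{d\nu/d\tau}\big)^2d\tau$ for any $\tau\in\mathcal{M}_+(\Omega)$ with $\mu,\nu\ll\tau$ (the value is independent of $\tau$). *)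

theory Defs
  imports "HOL-Probability.Probability"
begin

abbreviation borel_on :: "'a::topological_space set \<Rightarrow> 'a measure" where
  "borel_on \<Omega> \<equiv> restrict_space borel \<Omega>"

text \<open>
  On a compact subset of Euclidean space the non-negative Radon measures are exactly the
  finite Borel measures.
\<close>

definition radon_measures :: "'a::topological_space set \<Rightarrow> 'a measure set" where
  "radon_measures \<Omega> = {\<mu>. sets \<mu> = sets (borel_on \<Omega>) \<and> finite_measure \<mu>}"

definition prob_measures :: "'a::topological_space set \<Rightarrow> 'a measure set" where
  "prob_measures \<Omega> = {\<mu>. sets \<mu> = sets (borel_on \<Omega>) \<and> prob_space \<mu>}"

abbreviation dirac :: "'a::topological_space set \<Rightarrow> 'a \<Rightarrow> 'a measure" where
  "dirac \<Omega> x \<equiv> return (borel_on \<Omega>) x"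

definition is_atom :: "'a measure \<Rightarrow> 'a set \<Rightarrow> bool" where
  "is_atom \<mu> A \<longleftrightarrow> A \<in> sets \<mu> \<and> 0 < emeasure \<mu> A \<and>
     \<not> (\<exists>B\<in>sets \<mu>. B \<subseteq> A \<and> 0 < emeasure \<mu> B \<and> emeasure \<mu> B < emeasure \<mu> A)"

definition atomless :: "'a measure \<Rightarrow> bool" where
  "atomless \<mu> \<longleftrightarrow> \<not> (\<exists>A. is_atom \<mu> A)"

text \<open>The underlying \<open>\<sigma>\<close>-algebra is the one of the first argument.\<close>

definition add_measure :: "'a measure \<Rightarrow> 'a measure \<Rightarrow> 'a measure" where
  "add_measure \<mu> \<nu> = measure_of (space \<mu>) (sets \<mu>) (\<lambda>A. emeasure \<mu> A + emeasure \<nu> A)"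

definition suminf_measure :: "'a measure \<Rightarrow> (nat \<Rightarrow> 'a measure) \<Rightarrow> 'a measure" where
  "suminf_measure M \<mu> = measure_of (space M) (sets M) (\<lambda>A. \<Sum>i. emeasure (\<mu> i) A)"

definition weighted_diracs ::
    "'a::topological_space set \<Rightarrow> (nat \<Rightarrow> real) \<Rightarrow> (nat \<Rightarrow> 'a) \<Rightarrow> 'a measure" where
  "weighted_diracs \<Omega> m x =
     suminf_measure (borel_on \<Omega>) (\<lambda>i. scale_measure (ennreal (m i)) (dirac \<Omega> (x i)))"

lemma sets_add_measure [simp]: "sets (add_measure \<mu> \<nu>) = sets \<mu>"
  and space_add_measure [simp]: "space (add_measure \<mu> \<nu>) = space \<mu>"
  by (simp_all add: add_measure_def)

lemma emeasure_add_measure: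
  assumes "sets \<nu> = sets \<mu>" and "A \<in> sets \<mu>"
  shows "emeasure (add_measure \<mu> \<nu>) A = emeasure \<mu> A + emeasure \<nu> A"
  unfolding add_measure_def
proof (rule emeasure_measure_of_sigma)
  show "sigma_algebra (space \<mu>) (sets \<mu>)" by (rule sets.sigma_algebra_axioms)
  show "positive (sets \<mu>) (\<lambda>A. emeasure \<mu> A + emeasure \<nu> A)" by (simp add: positive_def)
  show "countably_additive (sets \<mu>) (\<lambda>A. emeasure \<mu> A + emeasure \<nu> A)"
    using assms(1) by (auto simp: countably_additive_def suminf_add[symmetric] suminf_emeasure)
qed fact

lemma sets_suminf_measure [simp]: "sets (suminf_measure M \<mu>) = sets M"
  and space_suminf_measure [simp]: "space (suminf_measure M \<mu>) = space M"
  by (simp_all add: suminf_measure_def)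

lemma emeasure_suminf_measure:
  assumes sets: "\<And>i. sets (\<mu> i) = sets M" and "A \<in> sets M"
  shows "emeasure (suminf_measure M \<mu>) A = (\<Sum>i. emeasure (\<mu> i) A)"
  unfolding suminf_measure_def
proof (rule emeasure_measure_of_sigma)
  show "sigma_algebra (space M) (sets M)" by (rule sets.sigma_algebra_axioms)
  show "positive (sets M) (\<lambda>A. \<Sum>i. emeasure (\<mu> i) A)" by (simp add: positive_def)
  show "countably_additive (sets M) (\<lambda>A. \<Sum>i. emeasure (\<mu> i) A)"
    unfolding countably_additive_def
  proof (intro allI impI)
    fix F :: "nat \<Rightarrow> 'a set"
    assume F: "range F \<subseteq> sets M" "disjoint_family F" "\<Union>(range F) \<in> sets M"
    have "(\<Sum>j. \<Sum>i. emeasure (\<mu> i) (F j))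
        = (\<Sum>j. \<integral>\<^sup>+i. emeasure (\<mu> i) (F j) \<partial>count_space UNIV)"
      by (simp add: nn_integral_count_space_nat)
    also have "\<dots> = (\<integral>\<^sup>+i. (\<Sum>j. emeasure (\<mu> i) (F j)) \<partial>count_space UNIV)"
      by (rule nn_integral_suminf[symmetric]) simp
    also have "\<dots> = (\<Sum>i. emeasure (\<mu> i) (\<Union>(range F)))"
      using F sets by (simp add: suminf_emeasure nn_integral_count_space_nat)
    finally show "(\<Sum>j. \<Sum>i. emeasure (\<mu> i) (F j)) = (\<Sum>i. emeasure (\<mu> i) (\<Union>(range F)))" .
  qed
qed fact

text \<open>Note that \<open>absolutely_continuous \<tau> \<mu>\<close> means that \<open>\<mu>\<close> is dominated by \<open>\<tau>\<close>.\<close>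

definition hellinger_sq_wrt :: "'a measure \<Rightarrow> 'a measure \<Rightarrow> 'a measure \<Rightarrow> ennreal" where
  "hellinger_sq_wrt \<tau> \<mu> \<nu> =
     (\<integral>\<^sup>+ y. ennreal ((sqrt (enn2real (RN_deriv \<tau> \<mu> y)) - sqrt (enn2real (RN_deriv \<tau> \<nu> y)))\<^sup>2) \<partial>\<tau>)"

definition hellinger_sq ::
    "'a::topological_space set \<Rightarrow> 'a measure \<Rightarrow> 'a measure \<Rightarrow> ennreal" where
  "hellinger_sq \<Omega> \<mu> \<nu> =
     (THE h. \<forall>\<tau>\<in>radon_measures \<Omega>.
        absolutely_continuous \<tau> \<mu> \<longrightarrow> absolutely_continuous \<tau> \<nu> \<longrightarrow> h = hellinger_sq_wrt \<tau> \<mu> \<nu>)"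

text \<open>
  The value does not depend on the dominating measure, so the description is well defined.
\<close>

lemma RN_deriv_chain:
  assumes \<sigma>: "finite_measure \<sigma>" and \<tau>: "finite_measure \<tau>"
    and sets: "sets \<tau> = sets \<sigma>" "sets \<mu> = sets \<sigma>"
    and ac: "absolutely_continuous \<sigma> \<tau>" "absolutely_continuous \<tau> \<mu>"
  shows "AE y in \<sigma>. RN_deriv \<sigma> \<mu> y = RN_deriv \<sigma> \<tau> y * RN_deriv \<tau> \<mu> y"
proof -
  interpret \<sigma>: finite_measure \<sigma> by fact
  interpret \<tau>: finite_measure \<tau> by fact
  have [measurable]: "RN_deriv \<tau> \<mu> \<in> borel_measurable \<sigma>"
    using borel_measurable_RN_deriv[of \<tau> \<mu>] measurable_cong_sets[OF sets(1) refl] by blast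
  have "density \<sigma> (\<lambda>y. RN_deriv \<sigma> \<tau> y * RN_deriv \<tau> \<mu> y)
      = density (density \<sigma> (RN_deriv \<sigma> \<tau>)) (RN_deriv \<tau> \<mu>)"
    by (simp add: density_density_eq)
  also have "\<dots> = \<mu>"
    using sets ac by (simp add: \<sigma>.density_RN_deriv \<tau>.density_RN_deriv)
  finally have "AE y in \<sigma>. RN_deriv \<sigma> \<tau> y * RN_deriv \<tau> \<mu> y = RN_deriv \<sigma> \<mu> y"
    by (intro \<sigma>.RN_deriv_unique) auto
  then show ?thesis by eventually_elim simp
qed

lemma hellinger_sq_wrt_mono:
  assumes \<sigma>: "finite_measure \<sigma>" and \<tau>: "finite_measure \<tau>"
    and sets: "sets \<tau> = sets \<sigma>" "sets \<mu> = sets \<sigma>" "sets \<nu> = sets \<sigma>"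
    and ac: "absolutely_continuous \<sigma> \<tau>" "absolutely_continuous \<tau> \<mu>" "absolutely_continuous \<tau> \<nu>"
  shows "hellinger_sq_wrt \<tau> \<mu> \<nu> = hellinger_sq_wrt \<sigma> \<mu> \<nu>"
proof -
  interpret \<sigma>: finite_measure \<sigma> by fact
  interpret \<tau>: finite_measure \<tau> by fact
  let ?F = "\<lambda>a b. ennreal ((sqrt (enn2real a) - sqrt (enn2real b))\<^sup>2)"
  have [measurable]: "RN_deriv \<tau> \<mu> \<in> borel_measurable \<sigma>" "RN_deriv \<tau> \<nu> \<in> borel_measurable \<sigma>"
    using borel_measurable_RN_deriv measurable_cong_sets[OF sets(1) refl] by blast+
  have hom: "h * ?F a b = ?F (h * a) (h * b)" if h: "h \<noteq> \<infinity>" for h a b :: ennreal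
  proof -
    obtain r where r: "0 \<le> r" "h = ennreal r" using h by (cases h) auto
    have "r * (sqrt (enn2real a) - sqrt (enn2real b))\<^sup>2
        = (sqrt r * (sqrt (enn2real a) - sqrt (enn2real b)))\<^sup>2"
      using r by (simp add: power_mult_distrib)
    also have "\<dots> = (sqrt (r * enn2real a) - sqrt (r * enn2real b))\<^sup>2"
      by (simp add: real_sqrt_mult right_diff_distrib)
    finally show ?thesis
      using r by (simp add: enn2real_mult ennreal_mult[symmetric])
  qed
  have "hellinger_sq_wrt \<tau> \<mu> \<nu>
      = (\<integral>\<^sup>+ y. ?F (RN_deriv \<tau> \<mu> y) (RN_deriv \<tau> \<nu> y) \<partial>density \<sigma> (RN_deriv \<sigma> \<tau>))"
    unfolding hellinger_sq_wrt_def using \<sigma>.density_RN_deriv[OF ac(1) sets(1)] by simp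
  also have "\<dots> = (\<integral>\<^sup>+ y. RN_deriv \<sigma> \<tau> y * ?F (RN_deriv \<tau> \<mu> y) (RN_deriv \<tau> \<nu> y) \<partial>\<sigma>)"
    by (rule nn_integral_density) measurable
  also have "\<dots> = hellinger_sq_wrt \<sigma> \<mu> \<nu>"
    unfolding hellinger_sq_wrt_def
  proof (rule nn_integral_cong_AE)
    show "AE y in \<sigma>. RN_deriv \<sigma> \<tau> y * ?F (RN_deriv \<tau> \<mu> y) (RN_deriv \<tau> \<nu> y)
        = ?F (RN_deriv \<sigma> \<mu> y) (RN_deriv \<sigma> \<nu> y)"
      using RN_deriv_chain[OF \<sigma> \<tau> sets(1,2) ac(1,2)] RN_deriv_chain[OF \<sigma> \<tau> sets(1,3) ac(1,3)]
        \<sigma>.RN_deriv_finite[OF \<tau>.sigma_finite_measure ac(1) sets(1)]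
      by eventually_elim (simp add: hom)
  qed
  finally show ?thesis .
qed

lemma add_measure_radon:
  assumes "\<mu> \<in> radon_measures \<Omega>" "\<nu> \<in> radon_measures \<Omega>"
  shows "add_measure \<mu> \<nu> \<in> radon_measures \<Omega>"
    and "absolutely_continuous (add_measure \<mu> \<nu>) \<mu>"
    and "absolutely_continuous (add_measure \<mu> \<nu>) \<nu>"
proof -
  have sets: "sets \<nu> = sets \<mu>" and fin: "finite_measure \<mu>" "finite_measure \<nu>"
    using assms by (auto simp: radon_measures_def)
  note em = emeasure_add_measure[OF sets]
  have sp: "space \<nu> = space \<mu>" using sets by (rule sets_eq_imp_space_eq)
  have "finite_measure (add_measure \<mu> \<nu>)"
    using fin sp finite_measure.emeasure_finite[OF fin(1), of "space \<mu>"]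
      finite_measure.emeasure_finite[OF fin(2), of "space \<mu>"]
    by (intro finite_measureI) (simp add: em)
  then show "add_measure \<mu> \<nu> \<in> radon_measures \<Omega>"
    using assms by (simp add: radon_measures_def)
  show "absolutely_continuous (add_measure \<mu> \<nu>) \<mu>" "absolutely_continuous (add_measure \<mu> \<nu>) \<nu>"
    using sets by (auto simp: absolutely_continuous_def null_sets_def em)
qed

lemma absolutely_continuous_trans:
  "absolutely_continuous \<sigma> \<tau> \<Longrightarrow> absolutely_continuous \<tau> \<mu> \<Longrightarrow> absolutely_continuous \<sigma> \<mu>"
  by (auto simp: absolutely_continuous_def)

lemma hellinger_sq_wrt_indep:
  assumes \<mu>\<nu>: "\<mu> \<in> radon_measures \<Omega>" "\<nu> \<in> radon_measures \<Omega>"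
    and \<tau>: "\<tau> \<in> radon_measures \<Omega>" "absolutely_continuous \<tau> \<mu>" "absolutely_continuous \<tau> \<nu>"
    and \<tau>': "\<tau>' \<in> radon_measures \<Omega>" "absolutely_continuous \<tau>' \<mu>" "absolutely_continuous \<tau>' \<nu>"
  shows "hellinger_sq_wrt \<tau> \<mu> \<nu> = hellinger_sq_wrt \<tau>' \<mu> \<nu>"
proof -
  note \<sigma> = add_measure_radon[OF \<tau>(1) \<tau>'(1)]
  have "hellinger_sq_wrt \<tau> \<mu> \<nu> = hellinger_sq_wrt (add_measure \<tau> \<tau>') \<mu> \<nu>"
    using \<mu>\<nu> \<tau> \<sigma> by (intro hellinger_sq_wrt_mono) (auto simp: radon_measures_def)
  moreover have "hellinger_sq_wrt \<tau>' \<mu> \<nu> = hellinger_sq_wrt (add_measure \<tau> \<tau>') \<mu> \<nu>"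
    using \<mu>\<nu> \<tau> \<tau>' \<sigma> by (intro hellinger_sq_wrt_mono) (auto simp: radon_measures_def)
  ultimately show ?thesis by simp
qed

theorem hellinger_sq_eq:
  assumes "\<mu> \<in> radon_measures \<Omega>" "\<nu> \<in> radon_measures \<Omega>"
    and "\<tau> \<in> radon_measures \<Omega>" "absolutely_continuous \<tau> \<mu>" "absolutely_continuous \<tau> \<nu>"
  shows "hellinger_sq \<Omega> \<mu> \<nu> = hellinger_sq_wrt \<tau> \<mu> \<nu>"
  unfolding hellinger_sq_def
proof (rule the_equality)
  show "\<forall>\<tau>'\<in>radon_measures \<Omega>. absolutely_continuous \<tau>' \<mu> \<longrightarrow> absolutely_continuous \<tau>' \<nu> \<longrightarrow>
      hellinger_sq_wrt \<tau> \<mu> \<nu> = hellinger_sq_wrt \<tau>' \<mu> \<nu>"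
    using hellinger_sq_wrt_indep[OF assms] by blast
qed (use assms in blast)

definition mean_hellinger_sq ::
    "'a::topological_space set \<Rightarrow> 'a measure \<Rightarrow> 'a measure \<Rightarrow> ennreal" where
  "mean_hellinger_sq \<Omega> \<rho> \<nu> = (\<integral>\<^sup>+ x. hellinger_sq \<Omega> (dirac \<Omega> x) \<nu> \<partial>\<rho>)"

end

theory Submission
  imports Defs
begin

text \<open>
  Integrating \<open>(\<surd>a - \<surd>b)\<^sup>2 + 2 \<surd>(a b) = a + b\<close> gives
  \<open>Hell\<^sup>2(\<delta>\<^sub>x, \<nu>) + 2 \<surd>\<nu>{x} = 1 + \<nu>(\<Omega>)\<close>. Integrating over \<open>\<rho>\<close>, only the atoms \<open>x\<^sub>i\<close>
  contribute to the square root term, and completing the square shows that the objective equals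
  \<open>1 - \<Sum>m\<^sub>i\<^sup>2 + \<Sum>(\<surd>\<nu>{x\<^sub>i} - m\<^sub>i)\<^sup>2 + \<nu>(\<Omega> - {x\<^sub>1, x\<^sub>2, \<dots>})\<close>.
\<close>

section \<open>Point masses and weighted sums of Diracs\<close>

lemma singleton_in_sets_borel_on:
  fixes y :: "'a::t1_space"
  assumes "y \<in> \<Omega>"
  shows "{y} \<in> sets (borel_on \<Omega>)"
proof -
  have "{y} = \<Omega> \<inter> {y}" using assms by auto
  then show ?thesis unfolding sets_restrict_space by (intro image_eqI) auto
qed

lemma space_borel_on [simp]: "space (borel_on \<Omega>) = \<Omega>"
  by (simp add: space_restrict_space)

text \<open>The only subsets of a singleton are itself and the empty set, and neither has mass
  strictly between zero and the mass of the point. A point of positive mass would therefore be an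
  atom.\<close>

lemma atomless_singleton:
  assumes "atomless \<mu>" "{y} \<in> sets \<mu>"
  shows "emeasure \<mu> {y} = 0"
proof (rule ccontr)
  assume "emeasure \<mu> {y} \<noteq> 0"
  then have "is_atom \<mu> {y}"
    using assms(2) by (auto simp: is_atom_def subset_singleton_iff zero_less_iff_neq_zero)
  then show False using assms(1) by (auto simp: atomless_def)
qed

lemma sets_weighted_diracs [simp]: "sets (weighted_diracs \<Omega> m x) = sets (borel_on \<Omega>)"
  by (simp add: weighted_diracs_def)

lemma emeasure_weighted_diracs:
  assumes "A \<in> sets (borel_on \<Omega>)"
  shows "emeasure (weighted_diracs \<Omega> m x) A = (\<Sum>i. ennreal (m i) * indicator A (x i))"
  using assms by (simp add: weighted_diracs_def emeasure_suminf_measure)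

lemma suminf_ennreal_single:
  fixes f :: "nat \<Rightarrow> ennreal"
  assumes "\<And>j. j \<noteq> i \<Longrightarrow> f j = 0"
  shows "(\<Sum>j. f j) = f i"
  using suminf_finite[of "{i}" f] assms by simp

lemma emeasure_weighted_diracs_singleton:
  fixes x :: "nat \<Rightarrow> 'a::t1_space"
  assumes "inj x" "x i \<in> \<Omega>"
  shows "emeasure (weighted_diracs \<Omega> m x) {x i} = ennreal (m i)"
proof -
  have "(\<Sum>j. ennreal (m j) * indicator {x i} (x j)) = ennreal (m i) * indicator {x i} (x i)"
    using assms(1) by (intro suminf_ennreal_single) (auto simp: indicator_def inj_def)
  then show ?thesis
    using singleton_in_sets_borel_on[OF assms(2)] by (simp add: emeasure_weighted_diracs)
qed

section \<open>Hellinger distance to a Dirac measure\<close>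

lemma dirac_radon:
  assumes "y \<in> \<Omega>"
  shows "dirac \<Omega> y \<in> radon_measures \<Omega>"
  using prob_space_return[of y "borel_on \<Omega>"] assms
  by (auto simp: radon_measures_def prob_space_def)

lemma density_at_singleton:
  assumes "f \<in> borel_measurable \<tau>" "{y} \<in> sets \<tau>"
  shows "emeasure (density \<tau> f) {y} = f y * emeasure \<tau> {y}"
proof -
  have "emeasure (density \<tau> f) {y} = (\<integral>\<^sup>+z. f y * indicator {y} z \<partial>\<tau>)"
    using assms by (auto simp: emeasure_density indicator_def intro!: nn_integral_cong)
  then show ?thesis using assms by (simp add: nn_integral_cmult_indicator)
qed

text \<open>Keeping the cross term of the binomial formula on the left makes every term
  non-negative, so the identity passes to \<open>ennreal\<close> without truncated
  subtraction.\<close>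

lemma ennreal_square_diff:
  assumes "0 \<le> u" "0 \<le> v"
  shows "ennreal ((u - v)\<^sup>2) + ennreal (2 * u * v) = ennreal (u\<^sup>2) + ennreal (v\<^sup>2)"
proof -
  have "ennreal ((u - v)\<^sup>2) + ennreal (2 * u * v) = ennreal ((u - v)\<^sup>2 + 2 * u * v)"
    using assms by (intro ennreal_plus[symmetric]) auto
  also have "(u - v)\<^sup>2 + 2 * u * v = u\<^sup>2 + v\<^sup>2" by (simp add: power2_diff)
  finally show ?thesis by simp
qed

text \<open>\<open>ennreal_square_diff\<close> is applied pointwise to the square roots of the two
  densities, which integrate to the total masses. The cross term lives only at \<open>y\<close>,
  because the density of the Dirac measure vanishes almost everywhere else, and its integral does
  not depend on \<open>\<tau>\<close>.\<close>

lemma hellinger_sq_wrt_dirac: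
  fixes y :: "'a::t1_space"
  assumes \<nu>: "\<nu> \<in> radon_measures \<Omega>" and y: "y \<in> \<Omega>" and \<tau>: "\<tau> \<in> radon_measures \<Omega>"
    and ac: "absolutely_continuous \<tau> (dirac \<Omega> y)" "absolutely_continuous \<tau> \<nu>"
  shows "hellinger_sq_wrt \<tau> (dirac \<Omega> y) \<nu> + ennreal (2 * sqrt (measure \<nu> {y}))
       = 1 + emeasure \<nu> \<Omega>"
proof -
  interpret \<tau>: finite_measure \<tau> using \<tau> by (simp add: radon_measures_def)
  interpret \<nu>: finite_measure \<nu> using \<nu> by (simp add: radon_measures_def)
  interpret D: finite_measure "dirac \<Omega> y" using dirac_radon[OF y] by (simp add: radon_measures_def)
  define a where "a = RN_deriv \<tau> (dirac \<Omega> y)"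
  define b where "b = RN_deriv \<tau> \<nu>"
  have s: "sets \<tau> = sets (borel_on \<Omega>)" "sets \<nu> = sets (borel_on \<Omega>)" "sets (dirac \<Omega> y) = sets \<tau>"
    "sets \<nu> = sets \<tau>"
    using \<nu> \<tau> by (auto simp: radon_measures_def)
  have sp: "space \<tau> = \<Omega>" using sets_eq_imp_space_eq[OF s(1)] by simp
  have \<Omega>: "\<Omega> \<in> sets \<tau>" using sp by auto
  have ys: "{y} \<in> sets \<tau>" using singleton_in_sets_borel_on[OF y] s by simp
  have [measurable]: "a \<in> borel_measurable \<tau>" "b \<in> borel_measurable \<tau>"
    by (simp_all add: a_def b_def)
  have da: "density \<tau> a = dirac \<Omega> y"
    unfolding a_def using ac s by (intro \<tau>.density_RN_deriv) auto
  have db: "density \<tau> b = \<nu>"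
    unfolding b_def using ac s by (intro \<tau>.density_RN_deriv) auto
  have fa: "AE z in \<tau>. a z \<noteq> \<infinity>"
    unfolding a_def using ac(1) s(3) by (intro \<tau>.RN_deriv_finite D.sigma_finite_measure)
  have fb: "AE z in \<tau>. b z \<noteq> \<infinity>"
    unfolding b_def using ac(2) s(4) by (intro \<tau>.RN_deriv_finite \<nu>.sigma_finite_measure)
  have ia: "(\<integral>\<^sup>+z. a z \<partial>\<tau>) = 1"
  proof -
    have "(\<integral>\<^sup>+z. a z \<partial>\<tau>) = emeasure (density \<tau> a) (space \<tau>)"
      by (auto simp: emeasure_density intro!: nn_integral_cong)
    also have "\<dots> = 1" using y \<Omega> s by (simp add: da sp)
    finally show ?thesis .
  qed
  have ib: "(\<integral>\<^sup>+z. b z \<partial>\<tau>) = emeasure \<nu> \<Omega>"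
  proof -
    have "(\<integral>\<^sup>+z. b z \<partial>\<tau>) = emeasure (density \<tau> b) (space \<tau>)"
      by (auto simp: emeasure_density intro!: nn_integral_cong)
    then show ?thesis by (simp add: db sp)
  qed
  have off: "AE z in \<tau>. z \<noteq> y \<longrightarrow> a z = 0"
  proof -
    have m: "\<Omega> - {y} \<in> sets \<tau>" using \<Omega> ys by auto
    have "emeasure (density \<tau> a) (\<Omega> - {y}) = 0"
      using m s by (simp add: da)
    then have "(\<integral>\<^sup>+z. a z * indicator (\<Omega> - {y}) z \<partial>\<tau>) = 0"
      using m by (simp add: emeasure_density)
    then have "AE z in \<tau>. a z * indicator (\<Omega> - {y}) z = 0"
      using m by (subst (asm) nn_integral_0_iff_AE) auto
    then show ?thesis using AE_space by eventually_elim (auto simp: sp indicator_def split: if_splits)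
  qed
  \<comment> \<open>The unit mass of the Dirac measure forces \<open>\<tau>\<close> to charge
    \<open>y\<close>, so the values of both densities at this single point are meaningful.\<close>
  have ay: "a y * emeasure \<tau> {y} = 1"
    using density_at_singleton[of a \<tau> y] ys s y by (simp add: da)
  have "b y * emeasure \<tau> {y} = emeasure \<nu> {y}"
    using density_at_singleton[of b \<tau> y] ys by (simp add: db)
  \<comment> \<open>\<open>enn2real\<close> is multiplicative on all of \<open>ennreal\<close>, with
    \<open>\<top>\<close> sent to 0, so this mass identity and the next transfer to the
    reals.\<close>
  then have by': "enn2real (b y) * measure \<tau> {y} = measure \<nu> {y}"
    by (metis enn2real_mult measure_def)
  have ay': "enn2real (a y) * measure \<tau> {y} = 1"
    using ay by (metis enn2real_mult measure_def enn2real_1)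
  define g where "g z = ennreal (2 * sqrt (enn2real (a z)) * sqrt (enn2real (b z)))" for z
  have [measurable]: "g \<in> borel_measurable \<tau>" unfolding g_def by measurable
  have "(\<integral>\<^sup>+z. g z \<partial>\<tau>) = (\<integral>\<^sup>+z. g y * indicator {y} z \<partial>\<tau>)"
    using off by (intro nn_integral_cong_AE, eventually_elim) (auto simp: g_def indicator_def)
  also have "\<dots> = g y * emeasure \<tau> {y}"
    using ys by (simp add: nn_integral_cmult_indicator)
  also have "\<dots> = ennreal (2 * sqrt (measure \<nu> {y}))"
  proof -
    \<comment> \<open>The factor \<open>measure \<tau> {y}\<close> is split into two equal square
      roots, one for each density; each product is then the square root of a point mass.\<close>
    have "sqrt (enn2real (a y)) * sqrt (enn2real (b y)) * measure \<tau> {y}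
        = sqrt (enn2real (a y) * measure \<tau> {y}) * sqrt (enn2real (b y) * measure \<tau> {y})"
      by (simp add: real_sqrt_mult)
    also have "\<dots> = sqrt (measure \<nu> {y})" unfolding ay' by' by simp
    finally show ?thesis
      by (simp add: g_def \<tau>.emeasure_eq_measure ennreal_mult[symmetric] mult.assoc)
  qed
  finally have ig: "(\<integral>\<^sup>+z. g z \<partial>\<tau>) = ennreal (2 * sqrt (measure \<nu> {y}))" .
  have "hellinger_sq_wrt \<tau> (dirac \<Omega> y) \<nu> + (\<integral>\<^sup>+z. g z \<partial>\<tau>)
      = (\<integral>\<^sup>+z. ennreal ((sqrt (enn2real (a z)) - sqrt (enn2real (b z)))\<^sup>2) + g z \<partial>\<tau>)"
    unfolding hellinger_sq_wrt_def a_def[symmetric] b_def[symmetric]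
    by (rule nn_integral_add[symmetric]) measurable
  also have "\<dots> = (\<integral>\<^sup>+z. a z + b z \<partial>\<tau>)"
  proof (rule nn_integral_cong_AE)
    \<comment> \<open>Finiteness of the densities matters here, since \<open>enn2real\<close> would
      replace an infinite value by 0.\<close>
    show "AE z in \<tau>. ennreal ((sqrt (enn2real (a z)) - sqrt (enn2real (b z)))\<^sup>2) + g z = a z + b z"
      using fa fb
    proof eventually_elim
      fix z assume "a z \<noteq> \<infinity>" "b z \<noteq> \<infinity>"
      then obtain r t where "0 \<le> r" "a z = ennreal r" "0 \<le> t" "b z = ennreal t"
        by (cases "a z"; cases "b z") auto
      then show "ennreal ((sqrt (enn2real (a z)) - sqrt (enn2real (b z)))\<^sup>2) + g z = a z + b z"
        using ennreal_square_diff[of "sqrt r" "sqrt t"] by (simp add: g_def)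
    qed
  qed
  also have "\<dots> = 1 + emeasure \<nu> \<Omega>" by (simp add: nn_integral_add ia ib)
  finally show ?thesis by (simp only: ig)
qed

text \<open>The sum of the two measures dominates both, so the distance can be evaluated with
  respect to it.\<close>

lemma hellinger_sq_dirac:
  fixes y :: "'a::t1_space"
  assumes \<nu>: "\<nu> \<in> radon_measures \<Omega>" and y: "y \<in> \<Omega>"
  shows "hellinger_sq \<Omega> (dirac \<Omega> y) \<nu> + ennreal (2 * sqrt (measure \<nu> {y})) = 1 + emeasure \<nu> \<Omega>"
  using add_measure_radon[OF dirac_radon[OF y] \<nu>]
  by (simp add: hellinger_sq_eq[OF dirac_radon[OF y] \<nu>] hellinger_sq_wrt_dirac[OF \<nu> y])

section \<open>Measures and integrals carried by countably many points\<close>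

lemma emeasure_countable_split:
  assumes "inj x" "\<And>i. {x i} \<in> sets \<nu>" "A \<in> sets \<nu>" "range x \<subseteq> A"
  shows "emeasure \<nu> A = (\<Sum>i. emeasure \<nu> {x i}) + emeasure \<nu> (A - range x)"
proof -
  have r: "range x = (\<Union>i. {x i})" by auto
  have rs: "range x \<in> sets \<nu>" unfolding r using assms(2) by auto
  have "(\<Sum>i. emeasure \<nu> {x i}) = emeasure \<nu> (\<Union>i. {x i})"
    using assms by (intro suminf_emeasure) (auto simp: disjoint_family_on_def inj_def)
  then show ?thesis
    using rs assms r emeasure_Un[of "range x" \<nu> A] by (simp add: Un_absorb1)
qed

text \<open>With no mass off \<open>range x\<close>, the mass of a measurable set is the sum of the
  masses of the points \<open>x i\<close> in it. This serves the uniqueness proof, where a minimizer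
  is identified through its point masses.\<close>

lemma measure_eqI_countable_support:
  fixes x :: "nat \<Rightarrow> 'a"
  assumes "sets \<mu> = sets \<nu>" "inj x" "\<And>i. {x i} \<in> sets \<nu>"
    and "\<And>i. emeasure \<mu> {x i} = emeasure \<nu> {x i}"
    and "emeasure \<mu> (space \<nu> - range x) = 0" "emeasure \<nu> (space \<nu> - range x) = 0"
  shows "\<mu> = \<nu>"
proof (rule measure_eqI)
  fix A assume A: "A \<in> sets \<mu>"
  have r: "range x = (\<Union>i. {x i})" by auto
  have rs: "range x \<in> sets \<nu>" unfolding r using assms(3) by auto
  have E: "emeasure M A = (\<Sum>i. emeasure M {x i} * indicator A (x i))"
    if s: "sets M = sets \<nu>" and 0: "emeasure M (space \<nu> - range x) = 0" for M
  proof -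
    have 1: "emeasure M (A - range x) = 0"
    proof -
      have "A \<subseteq> space \<nu>" using A assms(1) sets.sets_into_space by blast
      then have "emeasure M (A - range x) \<le> emeasure M (space \<nu> - range x)"
        using A assms(1) rs s by (intro emeasure_mono) auto
      then show ?thesis using 0 by simp
    qed
    have "emeasure M A = emeasure M (A \<inter> range x) + emeasure M (A - range x)"
      using A assms(1) rs s by (subst plus_emeasure) (auto simp: Int_Diff_Un)
    also have "A \<inter> range x = (\<Union>i. {x i} \<inter> A)" by auto
    also have "emeasure M (\<Union>i. {x i} \<inter> A) = (\<Sum>i. emeasure M ({x i} \<inter> A))"
      using A assms s
      by (intro suminf_emeasure[symmetric]) (auto simp: disjoint_family_on_def inj_def)
    also have "(\<lambda>i. emeasure M ({x i} \<inter> A)) = (\<lambda>i. emeasure M {x i} * indicator A (x i))"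
      by (auto simp: indicator_def)
    finally show ?thesis using 1 by simp
  qed
  show "emeasure \<mu> A = emeasure \<nu> A"
    using E[of \<mu>] E[of \<nu>] assms by simp
qed fact

text \<open>Up to a null set the integrand is a series of constants on the singletons
  \<open>{x i}\<close>, and a series of non-negative functions integrates term by term.\<close>

lemma nn_integral_atoms:
  fixes f :: "'a \<Rightarrow> ennreal"
  assumes f: "f \<in> borel_measurable \<rho>" and x: "inj x" "\<And>i. {x i} \<in> sets \<rho>"
    and supp: "AE y in \<rho>. y \<notin> range x \<longrightarrow> f y = 0"
  shows "(\<integral>\<^sup>+y. f y \<partial>\<rho>) = (\<Sum>i. f (x i) * emeasure \<rho> {x i})"
proof -
  have "(\<integral>\<^sup>+y. f y \<partial>\<rho>) = (\<integral>\<^sup>+y. (\<Sum>i. f (x i) * indicator {x i} y) \<partial>\<rho>)"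
    using supp
  proof (intro nn_integral_cong_AE, eventually_elim)
    fix y assume y: "y \<notin> range x \<longrightarrow> f y = 0"
    show "f y = (\<Sum>i. f (x i) * indicator {x i} y)"
    proof (cases "y \<in> range x")
      case True
      then obtain i where i: "y = x i" by auto
      have "(\<Sum>j. f (x j) * indicator {x j} y) = f (x i) * indicator {x i} y"
        using x(1) i by (intro suminf_ennreal_single) (auto simp: indicator_def inj_def)
      then show ?thesis using i by simp
    next
      case False
      then have "(\<lambda>i. f (x i) * indicator {x i} y) = (\<lambda>_. 0)"
        by (auto simp: fun_eq_iff indicator_def)
      then show ?thesis using y False by (simp only: suminf_zero) simp
    qed
  qed
  also have "\<dots> = (\<Sum>i. \<integral>\<^sup>+y. f (x i) * indicator {x i} y \<partial>\<rho>)"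
    using x(2) by (intro nn_integral_suminf) auto
  also have "\<dots> = (\<Sum>i. f (x i) * emeasure \<rho> {x i})"
    using x(2) by (simp add: nn_integral_cmult_indicator)
  finally show ?thesis .
qed

section \<open>Closed form of the objective\<close>

text \<open>The formula for the distance to a Dirac measure is integrated against
  \<open>\<rho>\<close>, which has total mass 1. The cross term lives on the countably many point
  masses of \<open>\<nu>\<close>, and \<open>\<rho>\<close> charges no point outside
  \<open>range x\<close>, so its integral becomes a sum.\<close>

lemma mean_hellinger_sq_atoms:
  fixes x :: "nat \<Rightarrow> 'a::t1_space"
  assumes \<nu>: "\<nu> \<in> radon_measures \<Omega>" and \<rho>: "\<rho> \<in> prob_measures \<Omega>"
    and x: "inj x" "\<And>i. x i \<in> \<Omega>"
    and atoms: "\<And>i. emeasure \<rho> {x i} = ennreal (m i)" and m: "\<And>i. 0 \<le> m i"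
    and null: "\<And>y. y \<in> \<Omega> - range x \<Longrightarrow> emeasure \<rho> {y} = 0"
  shows "mean_hellinger_sq \<Omega> \<rho> \<nu> + (\<Sum>i. ennreal (2 * sqrt (measure \<nu> {x i}) * m i))
       = 1 + emeasure \<nu> \<Omega>"
proof -
  interpret \<rho>: prob_space \<rho> using \<rho> by (simp add: prob_measures_def)
  interpret \<nu>: finite_measure \<nu> using \<nu> by (simp add: radon_measures_def)
  have s: "sets \<rho> = sets (borel_on \<Omega>)" "sets \<nu> = sets (borel_on \<Omega>)"
    using \<rho> \<nu> by (auto simp: radon_measures_def prob_measures_def)
  have sp: "space \<rho> = \<Omega>" using sets_eq_imp_space_eq[OF s(1)] by simp
  have sing: "{y} \<in> sets \<rho>" if "y \<in> \<Omega>" for y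
    using singleton_in_sets_borel_on[OF that] s by simp
  define f where "f y = sqrt (measure \<nu> {y})" for y
  \<comment> \<open>A finite measure has at most countably many points of positive mass. As
    \<open>f\<close> vanishes off this set, it is measurable as a countable modification of
    zero.\<close>
  define C where "C = {y. measure \<nu> {y} \<noteq> 0} \<inter> \<Omega>"
  have C: "countable C" unfolding C_def using \<nu>.countable_support by (rule countable_Int1)
  have [measurable]: "f \<in> borel_measurable \<rho>"
  proof (rule measurable_discrete_difference[of "\<lambda>_. 0"])
    show "countable C" by fact
    show "{y} \<in> sets \<rho>" if "y \<in> C" for y using that sing by (simp add: C_def)
    show "0 = f y" if "y \<in> space \<rho>" "y \<notin> C" for y using that by (simp add: f_def C_def sp)
  qed auto
  have supp: "AE y in \<rho>. y \<notin> range x \<longrightarrow> ennreal (2 * f y) = 0"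
  proof -
    \<comment> \<open>Each point of \<open>C\<close> outside \<open>range x\<close> is null for
      \<open>\<rho>\<close>; there are countably many, so almost every point avoids them
      all.\<close>
    have "AE y in \<rho>. \<forall>c\<in>C - range x. y \<noteq> c"
    proof (subst AE_ball_countable)
      show "countable (C - range x)" using C by auto
      show "\<forall>c\<in>C - range x. AE y in \<rho>. y \<noteq> c"
      proof
        fix c assume "c \<in> C - range x"
        then have "{c} \<in> null_sets \<rho>" using null sing by (auto simp: C_def null_sets_def)
        then show "AE y in \<rho>. y \<noteq> c" by (rule AE_I') auto
      qed
    qed
    then show ?thesis
      using AE_space by eventually_elim (auto simp: f_def C_def sp)
  qed
  \<comment> \<open>Subtracting the finite cross term gives an explicit integrand in
    \<open>f\<close>, hence a measurable one, as additivity of the integral requires below.\<close>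
  have h: "hellinger_sq \<Omega> (dirac \<Omega> y) \<nu> = ennreal (1 + measure \<nu> \<Omega> - 2 * f y)"
    if "y \<in> \<Omega>" for y
  proof -
    have e: "hellinger_sq \<Omega> (dirac \<Omega> y) \<nu> + ennreal (2 * f y) = ennreal (1 + measure \<nu> \<Omega>)"
      using hellinger_sq_dirac[OF \<nu> that] by (simp add: f_def \<nu>.emeasure_eq_measure)
    then have "hellinger_sq \<Omega> (dirac \<Omega> y) \<nu> = ennreal (1 + measure \<nu> \<Omega>) - ennreal (2 * f y)"
      by (metis ennreal_add_diff_cancel_right ennreal_neq_top)
    then show ?thesis by (simp add: ennreal_minus f_def del: ennreal_plus)
  qed
  have "mean_hellinger_sq \<Omega> \<rho> \<nu> + (\<integral>\<^sup>+y. ennreal (2 * f y) \<partial>\<rho>)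
      = (\<integral>\<^sup>+y. ennreal (1 + measure \<nu> \<Omega> - 2 * f y) \<partial>\<rho>) + (\<integral>\<^sup>+y. ennreal (2 * f y) \<partial>\<rho>)"
    unfolding mean_hellinger_sq_def
    by (intro arg_cong2[where f="(+)"] nn_integral_cong refl) (simp add: sp h)
  also have "\<dots> = (\<integral>\<^sup>+y. ennreal (1 + measure \<nu> \<Omega> - 2 * f y) + ennreal (2 * f y) \<partial>\<rho>)"
    by (rule nn_integral_add[symmetric]) measurable
  also have "\<dots> = (\<integral>\<^sup>+y. 1 + emeasure \<nu> \<Omega> \<partial>\<rho>)"
  proof (rule nn_integral_cong)
    fix y assume "y \<in> space \<rho>"
    then have "y \<in> \<Omega>" by (simp add: sp)
    then show "ennreal (1 + measure \<nu> \<Omega> - 2 * f y) + ennreal (2 * f y) = 1 + emeasure \<nu> \<Omega>"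
      using hellinger_sq_dirac[OF \<nu>] h by (simp add: f_def)
  qed
  also have "\<dots> = 1 + emeasure \<nu> \<Omega>" by (simp add: \<rho>.emeasure_space_1)
  also have "(\<integral>\<^sup>+y. ennreal (2 * f y) \<partial>\<rho>) = (\<Sum>i. ennreal (2 * f (x i)) * emeasure \<rho> {x i})"
    using x sing supp by (intro nn_integral_atoms) auto
  also have "\<dots> = (\<Sum>i. ennreal (2 * sqrt (measure \<nu> {x i}) * m i))"
    using m by (simp add: f_def atoms ennreal_mult)
  finally show ?thesis .
qed

text \<open>The mass of \<open>\<Omega>\<close> is split into the points \<open>x i\<close> and the
  rest, and the square is completed at each point. The squared weights are added on the left instead
  of being subtracted on the right, which keeps the identity inside \<open>ennreal\<close>.\<close>

lemma mean_hellinger_sq_excess: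
  fixes x :: "nat \<Rightarrow> 'a::t1_space"
  assumes \<nu>: "\<nu> \<in> radon_measures \<Omega>" and \<rho>: "\<rho> \<in> prob_measures \<Omega>"
    and x: "inj x" "\<And>i. x i \<in> \<Omega>"
    and atoms: "\<And>i. emeasure \<rho> {x i} = ennreal (m i)" and m: "\<And>i. 0 \<le> m i"
    and null: "\<And>y. y \<in> \<Omega> - range x \<Longrightarrow> emeasure \<rho> {y} = 0"
  shows "mean_hellinger_sq \<Omega> \<rho> \<nu> + (\<Sum>i. ennreal ((m i)\<^sup>2))
       = 1 + ((\<Sum>i. ennreal ((sqrt (measure \<nu> {x i}) - m i)\<^sup>2)) + emeasure \<nu> (\<Omega> - range x))"
proof -
  interpret \<nu>: finite_measure \<nu> using \<nu> by (simp add: radon_measures_def)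
  define c where "c i = 2 * sqrt (measure \<nu> {x i}) * m i" for i
  have s: "sets \<nu> = sets (borel_on \<Omega>)" using \<nu> by (auto simp: radon_measures_def)
  have sp: "space \<nu> = \<Omega>" using sets_eq_imp_space_eq[OF s] by simp
  have mean: "mean_hellinger_sq \<Omega> \<rho> \<nu> + (\<Sum>i. ennreal (c i)) = 1 + emeasure \<nu> \<Omega>"
    unfolding c_def using assms by (intro mean_hellinger_sq_atoms) auto
  \<comment> \<open>The sum of the cross terms is bounded by the finite right-hand side, so it may
    be cancelled at the end.\<close>
  then have fin: "(\<Sum>i. ennreal (c i)) \<noteq> \<top>"
    using \<nu>.emeasure_finite[of \<Omega>] by (metis ennreal_add_eq_top ennreal_one_neq_top)
  have split: "emeasure \<nu> \<Omega> = (\<Sum>i. emeasure \<nu> {x i}) + emeasure \<nu> (\<Omega> - range x)"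
    using x s sp singleton_in_sets_borel_on sets.top[of \<nu>]
    by (intro emeasure_countable_split) auto
  have "(\<Sum>i. ennreal ((m i)\<^sup>2)) + (\<Sum>i. emeasure \<nu> {x i})
      = (\<Sum>i. ennreal ((m i)\<^sup>2) + emeasure \<nu> {x i})"
    by (rule suminf_add) auto
  also have "\<dots> = (\<Sum>i. ennreal ((sqrt (measure \<nu> {x i}) - m i)\<^sup>2) + ennreal (c i))"
    using m by (simp add: \<nu>.emeasure_eq_measure c_def ennreal_square_diff) (simp add: add.commute)
  also have "\<dots> = (\<Sum>i. ennreal ((sqrt (measure \<nu> {x i}) - m i)\<^sup>2)) + (\<Sum>i. ennreal (c i))"
    by (rule suminf_add[symmetric]) auto
  finally have sq: "(\<Sum>i. ennreal ((m i)\<^sup>2)) + (\<Sum>i. emeasure \<nu> {x i})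
      = (\<Sum>i. ennreal ((sqrt (measure \<nu> {x i}) - m i)\<^sup>2)) + (\<Sum>i. ennreal (c i))" .
  \<comment> \<open>The claim is proved after adding the cross terms to both sides:
    \<open>mean\<close> absorbs them, and \<open>sq\<close> produces them again on the
    right.\<close>
  have "mean_hellinger_sq \<Omega> \<rho> \<nu> + (\<Sum>i. ennreal ((m i)\<^sup>2)) + (\<Sum>i. ennreal (c i))
      = (mean_hellinger_sq \<Omega> \<rho> \<nu> + (\<Sum>i. ennreal (c i))) + (\<Sum>i. ennreal ((m i)\<^sup>2))"
    by (simp only: ac_simps)
  also have "\<dots> = 1 + ((\<Sum>i. ennreal ((m i)\<^sup>2)) + (\<Sum>i. emeasure \<nu> {x i})) + emeasure \<nu> (\<Omega> - range x)"
    unfolding mean split by (simp only: ac_simps)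
  also have "\<dots> = 1 + ((\<Sum>i. ennreal ((sqrt (measure \<nu> {x i}) - m i)\<^sup>2))
      + emeasure \<nu> (\<Omega> - range x)) + (\<Sum>i. ennreal (c i))"
    unfolding sq by (simp only: ac_simps)
  finally show ?thesis
    unfolding add.commute[of _ "\<Sum>i. ennreal (c i)"] ennreal_add_left_cancel using fin by simp
qed

section \<open>Minimality and uniqueness of the sum with squared weights\<close>

theorem proposition4p10:
  fixes \<Omega> :: "(real ^ 'd) set"
    and \<rho> \<rho>\<^sub>c :: "(real ^ 'd) measure"
    and m :: "nat \<Rightarrow> real"
    and x :: "nat \<Rightarrow> real ^ 'd"
  assumes "compact \<Omega>" and "convex \<Omega>" and "interior \<Omega> \<noteq> {}"
    and "\<rho> \<in> prob_measures \<Omega>"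
    and "\<rho>\<^sub>c \<in> radon_measures \<Omega>" and "atomless \<rho>\<^sub>c"
    and "\<And>i. x i \<in> \<Omega>" and "inj x" and "\<And>i. 0 \<le> m i"
    and "\<rho> = add_measure \<rho>\<^sub>c (weighted_diracs \<Omega> m x)"
  shows "is_arg_min (mean_hellinger_sq \<Omega> \<rho>) (\<lambda>\<nu>. \<nu> \<in> radon_measures \<Omega>)
           (weighted_diracs \<Omega> (\<lambda>i. (m i)\<^sup>2) x)
       \<and> (\<forall>\<nu>. is_arg_min (mean_hellinger_sq \<Omega> \<rho>) (\<lambda>\<nu>. \<nu> \<in> radon_measures \<Omega>) \<nu>
             \<longrightarrow> \<nu> = weighted_diracs \<Omega> (\<lambda>i. (m i)\<^sup>2) x)"
proof -
  define \<nu>\<^sub>0 where "\<nu>\<^sub>0 = weighted_diracs \<Omega> (\<lambda>i. (m i)\<^sup>2) x"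
  define S where "S = (\<Sum>i. ennreal ((m i)\<^sup>2))"
  \<comment> \<open>The excess of a competitor over the minimal value \<open>1 - S\<close>: the
    first term compares its point masses with the squared weights, the second is its mass
    elsewhere.\<close>
  define D where "D \<nu> = (\<Sum>i. ennreal ((sqrt (measure \<nu> {x i}) - m i)\<^sup>2)) + emeasure \<nu> (\<Omega> - range x)"
    for \<nu> :: "(real ^ 'd) measure"
  interpret \<rho>: prob_space \<rho> using assms(4) by (simp add: prob_measures_def)
  have sc: "sets \<rho>\<^sub>c = sets (borel_on \<Omega>)" using assms(5) by (simp add: radon_measures_def)
  have spc: "space \<rho>\<^sub>c = \<Omega>" using sets_eq_imp_space_eq[OF sc] by simp
  have sing: "{y} \<in> sets (borel_on \<Omega>)" if "y \<in> \<Omega>" for y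
    using singleton_in_sets_borel_on[OF that] .
  have \<Omega>: "\<Omega> \<in> sets (borel_on \<Omega>)" using sets.top[of "borel_on \<Omega>"] by simp
  have r: "range x = (\<Union>i. {x i})" by auto
  have \<Omega>r: "\<Omega> - range x \<in> sets (borel_on \<Omega>)"
    unfolding r using sing \<Omega> assms(7) by auto
  have em: "emeasure \<rho> A = emeasure \<rho>\<^sub>c A + emeasure (weighted_diracs \<Omega> m x) A"
    if "A \<in> sets (borel_on \<Omega>)" for A
    using that sc unfolding assms(10) by (intro emeasure_add_measure) auto
  have c0: "emeasure \<rho>\<^sub>c {y} = 0" if "y \<in> \<Omega>" for y
    using assms(6) sing[OF that] sc by (intro atomless_singleton) auto
  have atoms: "emeasure \<rho> {x i} = ennreal (m i)" for i
    using em[OF sing] c0 assms(7,8) by (simp add: emeasure_weighted_diracs_singleton)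
  have null: "emeasure \<rho> {y} = 0" if "y \<in> \<Omega> - range x" for y
  proof -
    have "(\<lambda>i. ennreal (m i) * indicator {y} (x i)) = (\<lambda>_. 0)"
      using that by (auto simp: fun_eq_iff indicator_def)
    then have "emeasure (weighted_diracs \<Omega> m x) {y} = 0"
      using that sing by (simp only: emeasure_weighted_diracs suminf_zero Diff_iff)
    then show ?thesis
      using em[OF sing] c0 that by simp
  qed
  have excess: "mean_hellinger_sq \<Omega> \<rho> \<nu> + S = 1 + D \<nu>" if "\<nu> \<in> radon_measures \<Omega>" for \<nu>
    unfolding S_def D_def
    using that assms(4,7,8,9) atoms null by (intro mean_hellinger_sq_excess) auto
  \<comment> \<open>As masses of points under a probability measure, the weights are at most 1 and
    dominate their squares. Finiteness of \<open>S\<close> makes \<open>\<nu>\<^sub>0\<close> a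
    finite measure and lets \<open>S\<close> be cancelled in \<open>min\<close>.\<close>
  have "S \<le> (\<Sum>i. ennreal (m i))"
    unfolding S_def
  proof (intro suminf_le ennreal_leI)
    fix i
    have "ennreal (m i) \<le> 1" using atoms[of i] \<rho>.emeasure_le_1[of "{x i}"] by simp
    then show "(m i)\<^sup>2 \<le> m i"
      using assms(9)[of i] by (simp add: power2_eq_square mult_left_le)
  qed auto
  also have "\<dots> = emeasure (weighted_diracs \<Omega> m x) \<Omega>"
    using \<Omega> assms(7) by (simp add: emeasure_weighted_diracs)
  also have "\<dots> \<le> emeasure \<rho> \<Omega>" using em[OF \<Omega>] by simp
  also have "\<dots> < \<top>" by (simp add: \<rho>.emeasure_eq_measure)
  finally have S: "S < \<top>" .
  have \<nu>\<^sub>0\<Omega>: "emeasure \<nu>\<^sub>0 \<Omega> = S"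
    using \<Omega> assms(7) by (simp add: \<nu>\<^sub>0_def S_def emeasure_weighted_diracs)
  have s0: "sets \<nu>\<^sub>0 = sets (borel_on \<Omega>)" by (simp add: \<nu>\<^sub>0_def)
  have sp0: "space \<nu>\<^sub>0 = \<Omega>" using sets_eq_imp_space_eq[OF s0] by simp
  have rad: "\<nu>\<^sub>0 \<in> radon_measures \<Omega>"
    using S \<nu>\<^sub>0\<Omega> by (auto simp: radon_measures_def s0 sp0 intro!: finite_measureI)
  have a0: "emeasure \<nu>\<^sub>0 {x i} = ennreal ((m i)\<^sup>2)" for i
    unfolding \<nu>\<^sub>0_def using assms(7,8) by (simp add: emeasure_weighted_diracs_singleton)
  have off0: "emeasure \<nu>\<^sub>0 (\<Omega> - range x) = 0"
    unfolding \<nu>\<^sub>0_def using \<Omega>r by (simp add: emeasure_weighted_diracs)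
  have "D \<nu>\<^sub>0 = 0"
    using assms(9) by (simp add: D_def off0 measure_def a0)
  then have J0: "mean_hellinger_sq \<Omega> \<rho> \<nu>\<^sub>0 + S = 1" using excess[OF rad] by simp
  have min: "mean_hellinger_sq \<Omega> \<rho> \<nu>\<^sub>0 \<le> mean_hellinger_sq \<Omega> \<rho> \<nu>" if "\<nu> \<in> radon_measures \<Omega>" for \<nu>
  proof -
    have "S + mean_hellinger_sq \<Omega> \<rho> \<nu>\<^sub>0 \<le> S + mean_hellinger_sq \<Omega> \<rho> \<nu>"
      using J0 excess[OF that] by (simp add: add.commute)
    then show ?thesis using S by (auto simp: ennreal_add_left_cancel_le)
  qed
  have uniq: "\<nu> = \<nu>\<^sub>0"
    if \<nu>: "\<nu> \<in> radon_measures \<Omega>" and le: "mean_hellinger_sq \<Omega> \<rho> \<nu> \<le> mean_hellinger_sq \<Omega> \<rho> \<nu>\<^sub>0" for \<nu>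
  proof -
    interpret \<nu>: finite_measure \<nu> using \<nu> by (simp add: radon_measures_def)
    have s: "sets \<nu> = sets (borel_on \<Omega>)" using \<nu> by (simp add: radon_measures_def)
    \<comment> \<open>A competitor no worse than \<open>\<nu>\<^sub>0\<close> has zero excess, so
      both non-negative parts of \<open>D\<close> vanish: one fixes the point masses, the other
      confines the measure to \<open>range x\<close>.\<close>
    have "1 + D \<nu> \<le> 1 + 0"
      using excess[OF \<nu>] J0 le add_right_mono[OF le, of S] by simp
    then have "D \<nu> = 0" by (simp only: ennreal_add_left_cancel_le) auto
    then have 1: "emeasure \<nu> (\<Omega> - range x) = 0"
      and "(\<Sum>i. ennreal ((sqrt (measure \<nu> {x i}) - m i)\<^sup>2)) = 0"
      by (auto simp: D_def)
    then have "(sqrt (measure \<nu> {x i}) - m i)\<^sup>2 \<le> 0" for i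
      by (simp add: suminf_eq_zero_iff ennreal_eq_0_iff)
    then have "sqrt (measure \<nu> {x i}) = m i" for i by simp
    then have "measure \<nu> {x i} = (m i)\<^sup>2" for i
      by (metis measure_nonneg real_sqrt_pow2)
    then have "emeasure \<nu> {x i} = emeasure \<nu>\<^sub>0 {x i}" for i
      by (simp add: \<nu>.emeasure_eq_measure a0)
    then show ?thesis
      using s s0 sp0 sing 1 off0 assms(7,8)
      by (intro measure_eqI_countable_support[where x=x]) auto
  qed
  \<comment> \<open>\<open>is_arg_min\<close> asks that no admissible value be strictly smaller;
    since \<open>ennreal\<close> is linearly ordered, this is the inequality form of
    \<open>min\<close> and \<open>uniq\<close>.\<close>
  show ?thesis
    unfolding \<nu>\<^sub>0_def[symmetric] is_arg_min_def
    using rad min uniq by (auto simp: not_less)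
qed

end
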